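(* Let $G_a\neq G_b$ be two helical groups with structural data as in the context, and assume $\mathbf e_a\cdot\mathbf e_b>0$. Let $\mathbf x:(s_1,s_2)\to\mathbb R^2$ be a locally compatible interface between the phases $a$ and $b$ whose curvature satisfies $\kappa(s)=0$ for all $s\in(s_1,s_2)$. Then there are $\mathbf t\in\mathbb R^2$, $|\mathbf t|=1$, and $\mathbf c\in\mathbb R^2$ with $$\mathbf x(s)=(s-s_1)\mathbf t+\mathbf c,\qquad s\in(s_1,s_2)$$ (so that $\mathbf x(s_1):=\mathbf c$), and one of the following holds: (i) (Vertical interface) $\mathbf e_a=\mathbf e_b$, $\mathbf t\cdot\mathbf f_a=\mathbf t\cdot\mathbf f_b=0$, and $\mathbf t\cdot\mathbf g_a=\mathbf t\cdot\mathbf g_b\neq0$; (ii) (Horizontal interface) $\mathbf e_a=\mathbf e_b$, $\mathbf t\cdot\mathbf f_a=\mathbf t\cdot\mathbf f_b\neq0$, $\mathbf t\cdot\mathbf g_a=\mathbf t\cdot\mathbf g_b=0$, and $\mathbf r_a=\mathbf Q^b_{\mathbf x(s_1)\cdot(\mathbf f_b-\mathbf f_a)}\,\mathbf r_b$; (iii) (Helical interface) $\mathbf e_a=\mathbf e_b$, $\mathbf t\cdot\mathbf f_a=\mathbf t\cdot\mathbf f_b\neq0$, $\mathbf t\cdot\mathbf g_a=\mathbf t\cdot\mathbf g_b\neq0$, and $\mathbf r_a=\mathbf Q^b_{\mathbf x(s_1)\cdot(\mathbf f_b-\mathbf f_a)}\,\mathbf r_b$. In all cases $\mathbf z_a$ and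 $\mathbf z_b$ are restricted by the matching of positions at one point of the interface, e.g. $\mathbf y_a(\mathbf x(s_1))=\mathbf y_b(\mathbf x(s_1))$.
   Context: Isometries: $(\mathbf Q|\mathbf c)$ denotes the map $\mathbf x\mapsto\mathbf Q\mathbf x+\mathbf c$ of $\mathbb R^3$. Helical groups. For each phase $c\in\{a,b\}$ the following data are given: a unit vector $\mathbf e_c\in\mathbb R^3$; $\mathbf z_c,\mathbf p_c\in\mathbb R^3$ with $\mathbf r_c:=\mathbf p_c-\mathbf z_c\neq0$ and $\mathbf r_c\cdot\mathbf e_c=0$; $\tau_c\in\mathbb R\setminus\{0\}$; $\vartheta_c\in\mathbb R$; an integer $i_c\ge1$ and $\alpha_c=2\pi/i_c$. Let $\mathbf W^c$ be the linear map $\mathbf W^c\mathbf v=\mathbf e_c\times\mathbf v$, and let $\mathbf Q^c_\xi=\sin\xi\,\mathbf W^c+\cos\xi(\mathbf I-\mathbf e_c\otimes\mathbf e_c)+\mathbf e_c\otimes\mathbf e_c$ be the rotation with axis $\mathbf e_c$ and angle $\xi$. Put $g_c(n,m)=(\mathbf Q^c_{m\vartheta_c+n\alpha_c}\,|\,m\tau_c\mathbf e_c+(\mathbf I-\mathbf Q^c_{m\vartheta_c+n\alpha_c})\mathbf z_c)$ and $G_c=\{g_c(n,m):m\in\mathbb Z,\ n=1,\dots,i_c\}$. Nearest neighbor generators. Let $h_c$ be the smallest integer greater than $2|\mathbf r_c|^2/\tau_c^2-1/2$, and let $A_c$ be the set of integer pairs $(n,m)$ with $-i_c\le n\le i_c$,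 $|m|\le h_c$ and $g_c(n,m)\neq\mathrm{id}$. Among pairs in $A_c$ choose a minimizer of $d_c^2(n,m)=4|\mathbf r_c|^2\sin^2\frac{m\vartheta_c+n\alpha_c}{2}+m^2\tau_c^2$, and then a minimizer of $d_c^2$ over those pairs in $A_c$ that are not linearly dependent with the first one (as vectors of $\mathbb R^2$). Label these two pairs $(n_1^c,m_1^c)$, $(n_2^c,m_2^c)$ in an order such that $m_1^c\ne0$. Set $\psi_c=m_1^c\vartheta_c+n_1^c\alpha_c$, $\beta_c=m_2^c\vartheta_c+n_2^c\alpha_c$ and assume $-\pi/2\le\psi_c,\beta_c\le\pi/2$. Let $q_c^\star$ be the smallest positive integer of the form $-n\,i_c m_1^c/(n_1^cm_2^c-n_2^cm_1^c)$, $n\in\mathbb Z\setminus\{0\}$. Put $\mathbf f_c=(\psi_c,\beta_c)$, $\mathbf g_c=\tau_c(m_1^c,m_2^c)\in\mathbb R^2$. The nondegeneracy $m_1^cn_2^c\ne m_2^cn_1^c$ is equivalent to $\mathbf f_c\cdot\mathbf g_c^\perp\neq0$, where $(u_1,u_2)^\perp=(-u_2,u_1)$. Positions. For $\mathbf x\in\mathbb R^2$ let $\mathbf y_c(\mathbf x)=\mathbf Q^c_{\mathbf x\cdot\mathbf f_c}\mathbf r_c+(\mathbf x\cdot\mathbf g_c)\mathbf e_c+\mathbf z_c$. Interfaces. An interface is a twice continuously differentiable arclength-parameterized curve $\mathbf x=(\hat p,\hat q):(s_1,s_2)\to\mathbb R^2$ ($|\mathbf x'|=1$) with $0\le\hat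 q(s)\le\min\{q_a^\star,q_b^\star\}$. Its tangent is $\mathbf t(s)=\mathbf x'(s)$, its normal $\mathbf n(s)=\mathbf t(s)^\perp$, and its curvature $\kappa$ is defined by $\mathbf t'(s)=\kappa(s)\mathbf n(s)$. The interface is locally compatible (between phases $a$ and $b$) if $\frac{d}{ds}\mathbf y_a(\mathbf x(s))=\frac{d}{ds}\mathbf y_b(\mathbf x(s))$ for all $s\in(s_1,s_2)$ and, in addition, $\mathbf y_a$ and $\mathbf y_b$ agree at one point of the interface. *)

theory Defs
  imports "HOL-Analysis.Analysis" "HOL-Analysis.Cross3"
begin

text \<open>
  Linear maps of \<open>\<real>\<^sup>3\<close> are represented as functions \<open>real ^ 3 \<Rightarrow> real ^ 3\<close>.
\<close>

definition isometry_map :: "(real ^ 3 \<Rightarrow> real ^ 3) \<Rightarrow> real ^ 3 \<Rightarrow> real ^ 3 \<Rightarrow> real ^ 3" where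
  "isometry_map Q c = (\<lambda>x. Q x + c)"

text \<open>The tensor product \<open>e \<otimes> e\<close> acts by \<open>v \<mapsto> (e \<bullet> v) e\<close>.\<close>

definition rot :: "real ^ 3 \<Rightarrow> real \<Rightarrow> real ^ 3 \<Rightarrow> real ^ 3" where
  "rot e \<xi> v = sin \<xi> *\<^sub>R cross3 e v + cos \<xi> *\<^sub>R (v - (e \<bullet> v) *\<^sub>R e) + (e \<bullet> v) *\<^sub>R e"

text \<open>
  A phase consists of the structural parameters of a helical group (axis \<open>e\<close>, points \<open>z\<close>
  and \<open>p\<close>, \<open>\<tau>\<close>, \<open>\<vartheta>\<close> and \<open>i\<close>) together with its two labelled nearest neighbor
  generators \<open>(n\<^sub>1, m\<^sub>1)\<close> and \<open>(n\<^sub>2, m\<^sub>2)\<close>. Since minimizers need not be unique, the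
  generators are data constrained by a predicate, not functions of the other parameters.
\<close>

record phase =
  eaxis :: "real ^ 3"
  zpt :: "real ^ 3"
  ppt :: "real ^ 3"
  tau :: real
  theta :: real
  ind :: int
  gen1 :: "int \<times> int"
  gen2 :: "int \<times> int"

definition rvec :: "phase \<Rightarrow> real ^ 3" where
  "rvec c = ppt c - zpt c"

definition alpha :: "phase \<Rightarrow> real" where
  "alpha c = 2 * pi / of_int (ind c)"

definition helical_data :: "phase \<Rightarrow> bool" where
  "helical_data c \<longleftrightarrow> norm (eaxis c) = 1 \<and> rvec c \<noteq> 0 \<and> rvec c \<bullet> eaxis c = 0 \<and>
     tau c \<noteq> 0 \<and> ind c \<ge> 1"

definition angle :: "phase \<Rightarrow> int \<times> int \<Rightarrow> real" where
  "angle c = (\<lambda>(n, m). of_int m * theta c + of_int n * alpha c)"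

definition helical_elem :: "phase \<Rightarrow> int \<times> int \<Rightarrow> real ^ 3 \<Rightarrow> real ^ 3" where
  "helical_elem c = (\<lambda>(n, m). isometry_map (rot (eaxis c) (angle c (n, m)))
     ((of_int m * tau c) *\<^sub>R eaxis c + (zpt c - rot (eaxis c) (angle c (n, m)) (zpt c))))"

definition helical_group :: "phase \<Rightarrow> (real ^ 3 \<Rightarrow> real ^ 3) set" where
  "helical_group c = {helical_elem c (n, m) | n m. n \<in> {1..ind c}}"

definition hbound :: "phase \<Rightarrow> int" where
  "hbound c = (LEAST h. of_int h > 2 * (norm (rvec c))\<^sup>2 / (tau c)\<^sup>2 - 1 / 2)"

definition admissible :: "phase \<Rightarrow> (int \<times> int) set" where
  "admissible c = {(n, m). - ind c \<le> n \<and> n \<le> ind c \<and> \<bar>m\<bar> \<le> hbound c \<and>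
     helical_elem c (n, m) \<noteq> id}"

definition dist2 :: "phase \<Rightarrow> int \<times> int \<Rightarrow> real" where
  "dist2 c = (\<lambda>(n, m). 4 * (norm (rvec c))\<^sup>2 * (sin (angle c (n, m) / 2))\<^sup>2 +
     (of_int m)\<^sup>2 * (tau c)\<^sup>2)"

text \<open>
  Linear dependence over \<open>\<real>\<close> of the family of two vectors. The library predicate on sets
  would identify equal vectors and call \<open>{u, u}\<close> independent.
\<close>

definition lin_dep :: "int \<times> int \<Rightarrow> int \<times> int \<Rightarrow> bool" where
  "lin_dep = (\<lambda>(n, m) (n', m'). \<exists>u v :: real. (u \<noteq> 0 \<or> v \<noteq> 0) \<and>
     u * of_int n + v * of_int n' = 0 \<and> u * of_int m + v * of_int m' = 0)"

definition successive_minimizers :: "phase \<Rightarrow> int \<times> int \<Rightarrow> int \<times> int \<Rightarrow> bool" where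
  "successive_minimizers c u v \<longleftrightarrow>
     is_arg_min (dist2 c) (\<lambda>w. w \<in> admissible c) u \<and>
     is_arg_min (dist2 c) (\<lambda>w. w \<in> admissible c \<and> \<not> lin_dep u w) v"

definition psi :: "phase \<Rightarrow> real" where
  "psi c = angle c (gen1 c)"

definition beta :: "phase \<Rightarrow> real" where
  "beta c = angle c (gen2 c)"

definition nn_generators :: "phase \<Rightarrow> bool" where
  "nn_generators c \<longleftrightarrow>
     (successive_minimizers c (gen1 c) (gen2 c) \<or> successive_minimizers c (gen2 c) (gen1 c)) \<and>
     snd (gen1 c) \<noteq> 0 \<and> psi c \<in> {- pi / 2..pi / 2} \<and> beta c \<in> {- pi / 2..pi / 2}"

definition qstar :: "phase \<Rightarrow> int" where
  "qstar c = (case (gen1 c, gen2 c) of ((n1, m1), (n2, m2)) \<Rightarrow>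
     (LEAST q. q > 0 \<and> (\<exists>n::int. n \<noteq> 0 \<and>
        (of_int q :: real) = - (of_int (n * ind c * m1) / of_int (n1 * m2 - n2 * m1)))))"

definition fvec :: "phase \<Rightarrow> real ^ 2" where
  "fvec c = vector [psi c, beta c]"

definition gvec :: "phase \<Rightarrow> real ^ 2" where
  "gvec c = tau c *\<^sub>R vector [of_int (snd (gen1 c)), of_int (snd (gen2 c))]"

definition position :: "phase \<Rightarrow> real ^ 2 \<Rightarrow> real ^ 3" where
  "position c x = rot (eaxis c) (x \<bullet> fvec c) (rvec c) + (x \<bullet> gvec c) *\<^sub>R eaxis c + zpt c"

definition perp :: "real ^ 2 \<Rightarrow> real ^ 2" where
  "perp u = vector [- (u $ 2), u $ 1]"

definition tangent :: "(real \<Rightarrow> real ^ 2) \<Rightarrow> real \<Rightarrow> real ^ 2" where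
  "tangent x s = vector_derivative x (at s)"

definition normal_vec :: "(real \<Rightarrow> real ^ 2) \<Rightarrow> real \<Rightarrow> real ^ 2" where
  "normal_vec x s = perp (tangent x s)"

text \<open>
  The description below determines a unique number whenever \<open>x\<close> is a twice differentiable
  arclength-parameterized curve, as the tangent is then orthogonal to its derivative.
\<close>

definition curvature :: "(real \<Rightarrow> real ^ 2) \<Rightarrow> real \<Rightarrow> real" where
  "curvature x s = (THE k. vector_derivative (tangent x) (at s) = k *\<^sub>R normal_vec x s)"

definition interface :: "phase \<Rightarrow> phase \<Rightarrow> real \<Rightarrow> real \<Rightarrow> (real \<Rightarrow> real ^ 2) \<Rightarrow> bool" where
  "interface a b s1 s2 x \<longleftrightarrow>
     x C1_differentiable_on {s1<..<s2} \<and> tangent x C1_differentiable_on {s1<..<s2} \<and>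
     (\<forall>s\<in>{s1<..<s2}. norm (tangent x s) = 1 \<and>
        0 \<le> x s $ 2 \<and> x s $ 2 \<le> of_int (min (qstar a) (qstar b)))"

definition locally_compatible ::
    "phase \<Rightarrow> phase \<Rightarrow> real \<Rightarrow> real \<Rightarrow> (real \<Rightarrow> real ^ 2) \<Rightarrow> bool" where
  "locally_compatible a b s1 s2 x \<longleftrightarrow>
     (\<forall>s\<in>{s1<..<s2}. vector_derivative (\<lambda>\<sigma>. position a (x \<sigma>)) (at s) =
        vector_derivative (\<lambda>\<sigma>. position b (x \<sigma>)) (at s)) \<and>
     (\<exists>s\<in>{s1<..<s2}. position a (x s) = position b (x s))"

end

theory Submission
  imports Defs
begin

text \<open>
  Zero curvature makes the interface a straight line \<open>s \<mapsto> (s - s\<^sub>1) t + c\<close>, so each \<open>y\<^sub>c\<close> runs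
  along a helix of angular speed \<open>\<omega>\<^sub>c = t \<bullet> f\<^sub>c\<close> and axial speed \<open>\<gamma>\<^sub>c = t \<bullet> g\<^sub>c\<close>. Differentiating
  the compatibility condition once and twice more yields \<open>\<omega>\<^sub>a\<^sup>2 v\<^sub>a = \<omega>\<^sub>b\<^sup>2 v\<^sub>b\<close> and
  \<open>\<omega>\<^sub>a\<^sup>3 v\<^sub>a' = \<omega>\<^sub>b\<^sup>3 v\<^sub>b'\<close> for the rotating radii \<open>v\<^sub>c\<close> and their derivatives \<open>v\<^sub>c'\<close> in the angle.
  Norms give \<open>\<bar>\<omega>\<^sub>a\<bar> = \<bar>\<omega>\<^sub>b\<bar>\<close>, and since \<open>v\<^sub>c \<times> v\<^sub>c'\<close> is a positive multiple of \<open>e\<^sub>c\<close>, the axes and the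
  signs agree when \<open>\<omega>\<^sub>a \<noteq> 0\<close>. When \<open>\<omega>\<^sub>a = \<omega>\<^sub>b = 0\<close>, linear independence of the
  generators forces \<open>\<gamma>\<^sub>c \<noteq> 0\<close>.
\<close>

section \<open>Rotations about a unit axis and their derivatives\<close>

text \<open>Derivative of \<open>rot\<close> in the angle. On vectors orthogonal to \<open>e\<close>
  it equals \<open>rot\<close> with the angle increased by a quarter turn.\<close>

definition drot :: "real ^ 3 \<Rightarrow> real \<Rightarrow> real ^ 3 \<Rightarrow> real ^ 3" where
  "drot e \<xi> v = cos \<xi> *\<^sub>R cross3 e v - sin \<xi> *\<^sub>R (v - (e \<bullet> v) *\<^sub>R e)"

lemma rot_has_vector_derivative:
  assumes "(h has_real_derivative w) (at s)"
  shows "((\<lambda>\<sigma>. rot e (h \<sigma>) v) has_vector_derivative w *\<^sub>R drot e (h s) v) (at s)"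
  unfolding rot_def drot_def
  by (rule derivative_eq_intros assms refl | simp add: algebra_simps)+

lemma drot_has_vector_derivative:
  assumes "(h has_real_derivative w) (at s)" "v \<bullet> e = 0"
  shows "((\<lambda>\<sigma>. drot e (h \<sigma>) v) has_vector_derivative - w *\<^sub>R rot e (h s) v) (at s)"
proof -
  have "e \<bullet> v = 0" using assms(2) by (simp add: inner_commute)
  then show ?thesis
    unfolding rot_def drot_def
    by - (rule derivative_eq_intros assms(1) refl | simp add: algebra_simps)+
qed

lemma drot_inner_axis:
  assumes "v \<bullet> e = 0"
  shows "drot e \<xi> v \<bullet> e = 0"
  using assms by (simp add: drot_def inner_diff_right inner_commute[of _ e] dot_cross_self)

lemma cross3_axis_twice:
  assumes "norm e = 1" "v \<bullet> e = 0"
  shows "cross3 e (cross3 e v) = - v"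
  using assms by (simp add: Lagrange inner_commute norm_eq_1)

text \<open>The two factors are \<open>v\<close> and \<open>cross3 e v\<close> turned by the same
  angle, so the oriented area they span does not depend on \<open>\<xi>\<close>. This recovers the
  axis, with its orientation, from the motion.\<close>

lemma rot_cross_drot:
  assumes "norm e = 1" "v \<bullet> e = 0"
  shows "cross3 (rot e \<xi> v) (drot e \<xi> v) = (norm v)\<^sup>2 *\<^sub>R e"
proof -
  have ev: "e \<bullet> v = 0" using assms(2) by (simp add: inner_commute)
  have vU: "cross3 v (cross3 e v) = (norm v)\<^sup>2 *\<^sub>R e"
    using assms(2) by (simp add: Lagrange power2_norm_eq_inner)
  have Uv: "cross3 (cross3 e v) v = - ((norm v)\<^sup>2 *\<^sub>R e)"
    using cross_skew[of "cross3 e v" v] vU by simp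
  have "cross3 (rot e \<xi> v) (drot e \<xi> v)
      = (sin \<xi> * sin \<xi> + cos \<xi> * cos \<xi>) *\<^sub>R ((norm v)\<^sup>2 *\<^sub>R e)"
    by (simp add: rot_def drot_def ev cross_add_left Cross3.right_diff_distrib vU Uv
        cross_mult_left cross_mult_right scaleR_left_distrib distrib_right mult.assoc)
  also have "sin \<xi> * sin \<xi> + cos \<xi> * cos \<xi> = 1"
    using sin_cos_squared_add[of \<xi>] by (simp add: power2_eq_square)
  finally show ?thesis by simp
qed

lemma norm_rot:
  assumes "norm e = 1" "v \<bullet> e = 0"
  shows "norm (rot e \<xi> v) = norm v"
proof -
  have ev: "e \<bullet> v = 0" using assms(2) by (simp add: inner_commute)
  have UU: "cross3 e v \<bullet> cross3 e v = v \<bullet> v"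
    using assms(1) by (simp add: dot_cross ev norm_eq_1)
  have "rot e \<xi> v \<bullet> rot e \<xi> v = (sin \<xi>)\<^sup>2 * (v \<bullet> v) + (cos \<xi>)\<^sup>2 * (v \<bullet> v)"
    by (simp add: rot_def ev inner_add_left inner_add_right UU dot_cross_self power2_eq_square)
  also have "\<dots> = v \<bullet> v"
    by (simp flip: distrib_right)
  finally show ?thesis by (simp add: norm_eq_sqrt_inner)
qed

lemma rot_zero: "rot e 0 v = v"
  by (simp add: rot_def)

lemma rot_rot:
  assumes "norm e = 1" "v \<bullet> e = 0"
  shows "rot e \<xi> (rot e \<eta> v) = rot e (\<xi> + \<eta>) v"
proof -
  have ev: "e \<bullet> v = 0" using assms(2) by (simp add: inner_commute)
  show ?thesis
    by (simp add: rot_def ev cross_add_right cross_mult_right cross3_axis_twice[OF assms]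
        inner_add_right dot_cross_self sin_add cos_add algebra_simps)
qed

section \<open>Comparison of two helical motions\<close>

text \<open>Norms give \<open>p = q\<close> up to sign, and the positive inner product excludes
  opposite vectors.\<close>

lemma unit_vectors_parallel:
  fixes e e' :: "'a::real_inner"
  assumes "norm e = 1" "norm e' = 1" "e \<bullet> e' > 0" "p *\<^sub>R e = q *\<^sub>R e'" "p \<noteq> 0"
  shows "e = e' \<and> p = q"
proof -
  have "\<bar>p\<bar> = \<bar>q\<bar>"
    using assms by (metis mult.right_neutral norm_scaleR)
  moreover have "p * (e \<bullet> e') = q"
    using arg_cong[OF assms(4), of "\<lambda>v. v \<bullet> e'"] assms(2) by (simp add: norm_eq_1)
  ultimately have "p = q"
    using assms(3,5) by (smt (verit) mult_pos_pos mult_neg_pos)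
  then show ?thesis using assms(4,5) by simp
qed

lemma has_vector_derivative_eq_on_open:
  assumes "open S" "s \<in> S" "\<And>\<sigma>. \<sigma> \<in> S \<Longrightarrow> f \<sigma> = g \<sigma>"
    and "(f has_vector_derivative f') (at s)" "(g has_vector_derivative g') (at s)"
  shows "f' = g'"
  using has_vector_derivative_transform_within_open[OF assms(4,1,2,3)] assms(5)
    vector_derivative_unique_at by blast

text \<open>The axial terms are constant, so one differentiation removes them and leaves only
  vectors orthogonal to the axes. Either neither motion rotates, or axes, speeds and phases can be
  compared.\<close>

lemma helix_velocities_agree:
  fixes ea eb ra rb :: "real ^ 3"
  assumes "norm ea = 1" "norm eb = 1" "ra \<bullet> ea = 0" "rb \<bullet> eb = 0" "ra \<noteq> 0" "rb \<noteq> 0"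
    and pos: "ea \<bullet> eb > 0"
    and S: "open S" "s0 \<in> S"
    and ha: "\<And>s. (ha has_real_derivative wa) (at s)"
    and hb: "\<And>s. (hb has_real_derivative wb) (at s)"
    and eq: "\<And>s. s \<in> S \<Longrightarrow>
      wa *\<^sub>R drot ea (ha s) ra + ka *\<^sub>R ea = wb *\<^sub>R drot eb (hb s) rb + kb *\<^sub>R eb"
  shows "wa = 0 \<and> wb = 0 \<and> ka *\<^sub>R ea = kb *\<^sub>R eb \<or>
    wa \<noteq> 0 \<and> ea = eb \<and> wa = wb \<and> ka = kb \<and> ra = rot eb (hb s0 - ha s0) rb"
proof -
  have D1: "((\<lambda>s. w *\<^sub>R drot e (h s) r + k *\<^sub>R e) has_vector_derivative - w\<^sup>2 *\<^sub>R rot e (h s) r) (at s)"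
    if "\<And>s. (h has_real_derivative w) (at s)" "r \<bullet> e = 0" for w e h r k s
    by (rule derivative_eq_intros drot_has_vector_derivative that refl | simp add: power2_eq_square)+
  have eq1: "wa\<^sup>2 *\<^sub>R rot ea (ha s) ra = wb\<^sup>2 *\<^sub>R rot eb (hb s) rb" if "s \<in> S" for s
    using has_vector_derivative_eq_on_open[OF S(1) that eq D1[OF ha assms(3)] D1[OF hb assms(4)]]
    by simp
  \<comment> \<open>The common minus sign of the accelerations was cancelled in \<open>eq1\<close>,
    hence the positive cube here.\<close>
  have D2: "((\<lambda>s. w\<^sup>2 *\<^sub>R rot e (h s) r) has_vector_derivative w^3 *\<^sub>R drot e (h s) r) (at s)"
    if "\<And>s. (h has_real_derivative w) (at s)" for w e h r s
    by (rule derivative_eq_intros rot_has_vector_derivative that refl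
        | simp add: power2_eq_square power3_eq_cube)+
  have eq2: "wa^3 *\<^sub>R drot ea (ha s0) ra = wb^3 *\<^sub>R drot eb (hb s0) rb"
    by (rule has_vector_derivative_eq_on_open[OF S(1,2) eq1 D2[OF ha] D2[OF hb]])
  have nrm: "wa\<^sup>2 * norm ra = wb\<^sup>2 * norm rb"
    using arg_cong[OF eq1[OF S(2)], of norm] assms by (simp add: norm_rot)
  show ?thesis
  proof (cases "wa = 0")
    case True
    then have "wb = 0" using nrm \<open>rb \<noteq> 0\<close> by simp
    then show ?thesis using True eq[OF S(2)] by simp
  next
    case False
    have "cross3 (wa\<^sup>2 *\<^sub>R rot ea (ha s0) ra) (wa^3 *\<^sub>R drot ea (ha s0) ra)
        = cross3 (wb\<^sup>2 *\<^sub>R rot eb (hb s0) rb) (wb^3 *\<^sub>R drot eb (hb s0) rb)"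
      by (simp only: eq1[OF S(2)] eq2)
    \<comment> \<open>The coefficient is \<open>wa^5 * (norm ra)^2\<close>, grouped so that by
      \<open>nrm\<close> its squared factor is the same on both sides; equal coefficients then give
      \<open>wa = wb\<close>.\<close>
    then have "(wa * (wa\<^sup>2 * norm ra)\<^sup>2) *\<^sub>R ea = (wb * (wb\<^sup>2 * norm rb)\<^sup>2) *\<^sub>R eb"
      using assms by (simp add: cross_mult_left cross_mult_right rot_cross_drot
          power_mult_distrib power2_eq_square power3_eq_cube algebra_simps)
    moreover have "wa * (wa\<^sup>2 * norm ra)\<^sup>2 \<noteq> 0" using False assms by simp
    ultimately have e: "ea = eb" and w: "wa * (wa\<^sup>2 * norm ra)\<^sup>2 = wb * (wb\<^sup>2 * norm rb)\<^sup>2"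
      using unit_vectors_parallel assms by metis+
    have w: "wa = wb" using w False assms by (simp add: nrm[symmetric])
    \<comment> \<open>Projecting the velocities onto the common axis removes the rotational
      terms.\<close>
    have "ka = kb"
      using arg_cong[OF eq[OF S(2)], of "\<lambda>v. v \<bullet> eb"] e assms
      by (simp add: inner_add_left drot_inner_axis norm_eq_1)
    moreover have "rot eb (ha s0) ra = rot eb (hb s0) rb"
      using eq1[OF S(2)] w e False by simp
    \<comment> \<open>Turning back by \<open>ha s0\<close> isolates \<open>ra\<close> and leaves the
      phase difference on the other side.\<close>
    then have "rot eb (- ha s0) (rot eb (ha s0) ra) = rot eb (- ha s0) (rot eb (hb s0) rb)"
      by simp
    then have "ra = rot eb (hb s0 - ha s0) rb"
      using assms e by (simp add: rot_rot rot_zero)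
    ultimately show ?thesis using e w False by blast
  qed
qed

section \<open>Independence of the generators and velocity of the positions\<close>

lemma lin_dep_sym: "lin_dep u v \<Longrightarrow> lin_dep v u"
  unfolding lin_dep_def by (auto simp: add.commute split: prod.splits) (metis add.commute)+

text \<open>The second minimizer ranges only over pairs independent of the first. Either generator
  may be the first one, hence the appeal to symmetry.\<close>

lemma generators_independent:
  assumes "nn_generators c"
  shows "\<not> lin_dep (gen1 c) (gen2 c)"
  using assms lin_dep_sym
  unfolding nn_generators_def successive_minimizers_def is_arg_min_def by blast

text \<open>The components of a nonzero \<open>t\<close> would be coefficients of a linear
  dependence of the generators: \<open>gvec\<close> gives the relation for the \<open>m\<close>
  entries since \<open>tau c\<close> is nonzero, and it cancels the \<open>theta\<close> part of
  \<open>fvec\<close>, leaving the relation for the \<open>n\<close> entries times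
  \<open>alpha c\<close>.\<close>

lemma fvec_gvec_independent:
  assumes "helical_data c" "nn_generators c" "t \<bullet> fvec c = 0" "t \<bullet> gvec c = 0"
  shows "t = 0"
proof (rule ccontr)
  assume "t \<noteq> 0"
  obtain n1 m1 n2 m2 where g: "gen1 c = (n1, m1)" "gen2 c = (n2, m2)"
    by (metis surj_pair)
  have m: "t $ 1 * m1 + t $ 2 * m2 = 0"
    using assms(1,4) unfolding helical_data_def gvec_def
    by (simp add: inner_vec_def[of t] sum_2 g mult.left_commute flip: distrib_left)
  have "t $ 1 * (m1 * theta c + n1 * alpha c) + t $ 2 * (m2 * theta c + n2 * alpha c) = 0"
    using assms(3) by (simp add: fvec_def inner_vec_def sum_2 g psi_def beta_def angle_def)
  then have "theta c * (t $ 1 * m1 + t $ 2 * m2) + alpha c * (t $ 1 * n1 + t $ 2 * n2) = 0"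
    by (simp add: algebra_simps)
  moreover have "alpha c \<noteq> 0"
    using assms(1) by (simp add: alpha_def helical_data_def)
  ultimately have n: "t $ 1 * n1 + t $ 2 * n2 = 0" using m by simp
  have "t $ 1 \<noteq> 0 \<or> t $ 2 \<noteq> 0"
    using \<open>t \<noteq> 0\<close> by (simp add: vec_eq_iff forall_2)
  with m n have "lin_dep (gen1 c) (gen2 c)" by (auto simp: lin_dep_def g)
  then show False using generators_independent assms(2) by blast
qed

lemma position_has_vector_derivative:
  assumes "(x has_vector_derivative t) (at s)"
  shows "((\<lambda>\<sigma>. position p (x \<sigma>)) has_vector_derivative
    (t \<bullet> fvec p) *\<^sub>R drot (eaxis p) (x s \<bullet> fvec p) (rvec p) + (t \<bullet> gvec p) *\<^sub>R eaxis p) (at s)"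
proof -
  have i: "((\<lambda>\<sigma>. x \<sigma> \<bullet> v) has_real_derivative t \<bullet> v) (at s)" for v
    using bounded_linear.has_vector_derivative[OF bounded_linear_inner_left assms]
    by (simp add: has_real_derivative_iff_has_vector_derivative)
  show ?thesis
    unfolding position_def
    by (rule derivative_eq_intros rot_has_vector_derivative i refl | simp)+
qed

section \<open>Plane curves of zero curvature\<close>

lemma orthogonal_unit_perp:
  assumes "norm t = 1" "t \<bullet> u = 0"
  shows "u = (u \<bullet> perp t) *\<^sub>R perp t"
proof -
  have 1: "t $ 1 * t $ 1 + t $ 2 * t $ 2 = 1" and 2: "t $ 1 * u $ 1 + t $ 2 * u $ 2 = 0"
    using assms by (simp_all add: norm_eq_1 inner_vec_def sum_2)
  \<comment> \<open>Each component is arranged to contain the two expressions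
    \<open>t \<bullet> t\<close> and \<open>t \<bullet> u\<close>, whose values are 1 and 0.\<close>
  have "(u $ 2 * t $ 1 - u $ 1 * t $ 2) * - t $ 2
      = u $ 1 * (t $ 1 * t $ 1 + t $ 2 * t $ 2) - t $ 1 * (t $ 1 * u $ 1 + t $ 2 * u $ 2)"
    "(u $ 2 * t $ 1 - u $ 1 * t $ 2) * t $ 1
      = u $ 2 * (t $ 1 * t $ 1 + t $ 2 * t $ 2) - t $ 2 * (t $ 1 * u $ 1 + t $ 2 * u $ 2)"
    by (simp_all add: algebra_simps)
  then show ?thesis
    using 1 2 by (simp add: vec_eq_iff forall_2 perp_def inner_vec_def sum_2)
qed

text \<open>Differentiating the constant squared length of the tangent shows that \<open>u\<close>
  is orthogonal to it, hence a multiple of the normal. The normal is nonzero, so the multiple is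
  unique and the description in \<open>curvature\<close> denotes it.\<close>

lemma tangent_derivative_curvature:
  assumes "open S" "s \<in> S" "\<And>\<sigma>. \<sigma> \<in> S \<Longrightarrow> norm (tangent x \<sigma>) = 1"
    and d: "(tangent x has_vector_derivative u) (at s)"
  shows "u = curvature x s *\<^sub>R normal_vec x s"
proof -
  have "((\<lambda>\<sigma>. tangent x \<sigma> \<bullet> tangent x \<sigma>) has_vector_derivative
      tangent x s \<bullet> u + u \<bullet> tangent x s) (at s)"
    by (rule bounded_bilinear.has_vector_derivative[OF bounded_bilinear_inner d d])
  moreover have "((\<lambda>_. 1 :: real) has_vector_derivative 0) (at s)" by simp
  ultimately have "tangent x s \<bullet> u + u \<bullet> tangent x s = 0"
    by (rule has_vector_derivative_eq_on_open[OF assms(1,2), rotated])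
      (use assms(3) in \<open>simp add: norm_eq_1\<close>)
  then have "tangent x s \<bullet> u = 0" by (simp add: inner_commute)
  from orthogonal_unit_perp[OF assms(3)[OF assms(2)] this] obtain k where k: "u = k *\<^sub>R normal_vec x s"
    unfolding normal_vec_def by blast
  have "tangent x s \<noteq> 0" using assms(2,3) by fastforce
  then have "normal_vec x s \<noteq> 0"
    by (simp add: normal_vec_def perp_def vec_eq_iff forall_2 conj_commute)
  then have "curvature x s = k"
    unfolding curvature_def vector_derivative_at[OF d] k by simp
  then show ?thesis using k by simp
qed

text \<open>The tangent has zero derivative, so it is a constant \<open>t\<close> on the interval;
  subtracting the linear motion along \<open>t\<close> leaves another constant, \<open>c\<close>,
  the limit of the curve at \<open>s1\<close>.\<close>

lemma interface_straight:
  assumes "interface a b s1 s2 x" "s1 < s2" "\<forall>s\<in>{s1<..<s2}. curvature x s = 0"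
  obtains t c where "norm t = 1" "\<And>s. s \<in> {s1<..<s2} \<Longrightarrow> x s = (s - s1) *\<^sub>R t + c"
proof -
  let ?S = "{s1<..<s2}"
  have nt: "\<And>s. s \<in> ?S \<Longrightarrow> norm (tangent x s) = 1"
    and x: "\<And>s. s \<in> ?S \<Longrightarrow> (x has_vector_derivative tangent x s) (at s)"
    and dt: "\<And>s. s \<in> ?S \<Longrightarrow> \<exists>u. (tangent x has_vector_derivative u) (at s)"
    using assms(1) unfolding interface_def C1_differentiable_on_def tangent_def
    by (blast, metis vector_derivative_at, blast)
  have dt0: "(tangent x has_vector_derivative 0) (at s within ?S)" if s: "s \<in> ?S" for s
  proof -
    obtain u where u: "(tangent x has_vector_derivative u) (at s)" using dt s by blast
    have "u = 0"
      using tangent_derivative_curvature[OF open_greaterThanLessThan s nt u] assms(3) s by simp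
    then show ?thesis using u has_vector_derivative_at_within by blast
  qed
  obtain t where t: "\<And>s. s \<in> ?S \<Longrightarrow> tangent x s = t"
    using has_vector_derivative_zero_constant[OF convex_real_interval(8) dt0] by blast
  have "((\<lambda>s. x s - (s - s1) *\<^sub>R t) has_vector_derivative 0) (at s within ?S)" if "s \<in> ?S" for s
    using x[OF that] t[OF that]
    by (auto intro!: derivative_eq_intros intro: has_vector_derivative_at_within)
  then obtain c where "\<And>s. s \<in> ?S \<Longrightarrow> x s - (s - s1) *\<^sub>R t = c"
    using has_vector_derivative_zero_constant[OF convex_real_interval(8)] by blast
  then have "\<And>s. s \<in> ?S \<Longrightarrow> x s = (s - s1) *\<^sub>R t + c"
    by (metis add.commute diff_add_cancel)
  moreover have "norm t = 1"
    using nt[of "(s1 + s2) / 2"] t[of "(s1 + s2) / 2"] assms(2) by simp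
  ultimately show ?thesis using that by blast
qed

section \<open>Classification of the straight interfaces\<close>

theorem theorem6p1:
  fixes a b :: phase and x :: "real \<Rightarrow> real ^ 2" and s1 s2 :: real
  assumes "helical_data a" and "nn_generators a"
    and "helical_data b" and "nn_generators b"
    and "helical_group a \<noteq> helical_group b"
    and "eaxis a \<bullet> eaxis b > 0"
    and "s1 < s2"
    and "interface a b s1 s2 x"
    and "locally_compatible a b s1 s2 x"
    and "\<forall>s\<in>{s1<..<s2}. curvature x s = 0"
  shows "\<exists>t c :: real ^ 2. norm t = 1 \<and>
    (\<forall>s\<in>{s1<..<s2}. x s = (s - s1) *\<^sub>R t + c) \<and>
    (eaxis a = eaxis b \<and> t \<bullet> fvec a = 0 \<and> t \<bullet> fvec b = 0 \<and>
       t \<bullet> gvec a = t \<bullet> gvec b \<and> t \<bullet> gvec b \<noteq> 0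
     \<or> eaxis a = eaxis b \<and> t \<bullet> fvec a = t \<bullet> fvec b \<and> t \<bullet> fvec b \<noteq> 0 \<and>
       t \<bullet> gvec a = 0 \<and> t \<bullet> gvec b = 0 \<and>
       rvec a = rot (eaxis b) (c \<bullet> (fvec b - fvec a)) (rvec b)
     \<or> eaxis a = eaxis b \<and> t \<bullet> fvec a = t \<bullet> fvec b \<and> t \<bullet> fvec b \<noteq> 0 \<and>
       t \<bullet> gvec a = t \<bullet> gvec b \<and> t \<bullet> gvec b \<noteq> 0 \<and>
       rvec a = rot (eaxis b) (c \<bullet> (fvec b - fvec a)) (rvec b)) \<and>
    position a c = position b c"
proof -
  let ?S = "{s1<..<s2}"
  obtain t c where t: "norm t = 1" and x: "\<And>s. s \<in> ?S \<Longrightarrow> x s = (s - s1) *\<^sub>R t + c"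
    using interface_straight assms by metis
  \<comment> \<open>The line extends the interface to all real parameters, in particular to
    \<open>s1\<close>, which lies outside \<open>?S\<close>.\<close>
  let ?x = "\<lambda>s. (s - s1) *\<^sub>R t + c"
  have dx: "(?x has_vector_derivative t) (at s)" for s
    by (auto intro!: derivative_eq_intros)
  have dxS: "(x has_vector_derivative t) (at s)" if "s \<in> ?S" for s
    by (rule has_vector_derivative_transform_within_open[OF dx _ that]) (auto simp: x)
  let ?v = "\<lambda>p s. (t \<bullet> fvec p) *\<^sub>R drot (eaxis p) (?x s \<bullet> fvec p) (rvec p) + (t \<bullet> gvec p) *\<^sub>R eaxis p"
  have v: "?v a s = ?v b s" if "s \<in> ?S" for s
    using assms(9) that position_has_vector_derivative[OF dxS[OF that]]
    unfolding locally_compatible_def by (metis (no_types, lifting) vector_derivative_at x)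
  have h: "((\<lambda>s. ?x s \<bullet> fvec p) has_real_derivative t \<bullet> fvec p) (at s)" for p s
    using bounded_linear.has_vector_derivative[OF bounded_linear_inner_left dx]
    by (simp add: has_real_derivative_iff_has_vector_derivative)
  define s0 where "s0 = (s1 + s2) / 2"
  have s0: "s0 \<in> ?S" using assms(7) by (simp add: s0_def)
  have dich: "t \<bullet> fvec a = 0 \<and> t \<bullet> fvec b = 0 \<and> (t \<bullet> gvec a) *\<^sub>R eaxis a = (t \<bullet> gvec b) *\<^sub>R eaxis b \<or>
    t \<bullet> fvec a \<noteq> 0 \<and> eaxis a = eaxis b \<and> t \<bullet> fvec a = t \<bullet> fvec b \<and> t \<bullet> gvec a = t \<bullet> gvec b \<and>
      rvec a = rot (eaxis b) (?x s0 \<bullet> fvec b - ?x s0 \<bullet> fvec a) (rvec b)"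
    using assms(1,3,6) unfolding helical_data_def
    by (intro helix_velocities_agree[where S = ?S, OF _ _ _ _ _ _ _ _ s0 h h v]) auto
  \<comment> \<open>The matching of positions at an inner point \<open>s'\<close> is carried to
    \<open>s1\<close>. Velocities are known to agree only inside \<open>?S\<close>, so
    \<open>s1\<close> is an exceptional point of the zero derivative, bridged by continuity.\<close>
  let ?D = "\<lambda>s. position a (?x s) - position b (?x s)"
  have D: "(?D has_vector_derivative ?v a s - ?v b s) (at s)" for s
    by (intro derivative_intros position_has_vector_derivative dx)
  obtain s' where s': "s' \<in> ?S" "position a (x s') = position b (x s')"
    using assms(9) unfolding locally_compatible_def by blast
  have "(?D has_derivative (\<lambda>_. 0)) (at s within {s1..s'})" if "s \<in> {s1..s'} - {s1}" for s
    using D[of s] v[of s] that s'(1)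
    by (auto simp: has_vector_derivative_def intro: has_derivative_at_withinI)
  moreover have "continuous_on {s1..s'} ?D"
    by (intro continuous_at_imp_continuous_on ballI has_vector_derivative_continuous[OF D])
  ultimately have "?D s' = ?D s1"
    using has_derivative_zero_unique_strong_interval[of "{s1}" s1 s' ?D "?D s1" s'] s'(1) by auto
  then have pos: "position a c = position b c" using s' x by simp
  \<comment> \<open>With equal angular speeds the phase difference is constant along the line, so
    its value at \<open>s0\<close> is the one at \<open>c\<close>.\<close>
  have c: "?x s0 \<bullet> fvec b - ?x s0 \<bullet> fvec a = c \<bullet> (fvec b - fvec a)" if "t \<bullet> fvec a = t \<bullet> fvec b"
    using that by (simp add: inner_add_left inner_diff_right)
  have v0: "eaxis a = eaxis b \<and> t \<bullet> gvec a = t \<bullet> gvec b \<and> t \<bullet> gvec b \<noteq> 0"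
    if "t \<bullet> fvec a = 0" "(t \<bullet> gvec a) *\<^sub>R eaxis a = (t \<bullet> gvec b) *\<^sub>R eaxis b"
  proof -
    \<comment> \<open>A unit tangent cannot annihilate both \<open>fvec a\<close> and
      \<open>gvec a\<close>, so without rotation the axial speed is nonzero.\<close>
    have ne: "t \<bullet> gvec a \<noteq> 0" using fvec_gvec_independent assms(1,2) that(1) t by fastforce
    show ?thesis
      using unit_vectors_parallel[OF _ _ assms(6) that(2) ne] assms(1,3) ne
      unfolding helical_data_def by simp
  qed
  show ?thesis
    using dich
  proof (elim disjE conjE)
    assume "t \<bullet> fvec a = 0" "t \<bullet> fvec b = 0"
      "(t \<bullet> gvec a) *\<^sub>R eaxis a = (t \<bullet> gvec b) *\<^sub>R eaxis b"
    with v0 t x pos show ?thesis by blast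
  next
    assume *: "t \<bullet> fvec a \<noteq> 0" "eaxis a = eaxis b" "t \<bullet> fvec a = t \<bullet> fvec b"
      "t \<bullet> gvec a = t \<bullet> gvec b"
      "rvec a = rot (eaxis b) (?x s0 \<bullet> fvec b - ?x s0 \<bullet> fvec a) (rvec b)"
    have r: "rvec a = rot (eaxis b) (c \<bullet> (fvec b - fvec a)) (rvec b)"
      using *(5) c[OF *(3)] by simp
    have f: "t \<bullet> fvec b \<noteq> 0" using *(1,3) by simp
    show ?thesis
    \<comment> \<open>Zero common axial speed gives the horizontal type, nonzero the helical
      one.\<close>
    proof (cases "t \<bullet> gvec b = 0")
      case True
      then have "t \<bullet> gvec a = 0" using *(4) by simp
      with True *(2,3) f r t x pos show ?thesis by blast
    next
      case False
      with *(2,3,4) f r t x pos show ?thesis by blast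
    qed
  qed
qed

end
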